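(* Let $\Omega$ be an at most countable set, $\mathcal{F}=2^\Omega$, and let $(\Omega_t^+)_{t\in\mathbb{N}_0}$, $(\Omega_t^-)_{t\in\mathbb{N}_0}$ be the actual and latent parts of $\Omega$ produced by a discovery process. Let $\mathcal{P}$ be a set of (countably additive) probability measures on $(\Omega,\mathcal{F})$, and let $\mathcal{P}_\infty^{ex}$ be the set of limits, in the extended total variation metric $d_{ETV}$, of the sequences $(P_t^{ex})_{t\in\mathbb{N}_0}$ of successive updates of the extended probabilities $P_0^{ex}$ induced by the elements $P\in\mathcal{P}$. Suppose that $\bigcup_{t\in\mathbb{N}_0}\Omega_t^+=\Omega'\subsetneq\Omega$, where $\Omega'$ is finite or countable, and put $\mathcal{F}'=2^{\Omega'}$. Then for every $P_\infty^{ex}\in\mathcal{P}_\infty^{ex}$, the set function $$\tilde P(A)=c\,P_\infty^{ex}(A),\quad A\in\mathcal{F}',\qquad c=\frac{1}{\sum_{\omega\in\Omega'}P_\infty^{ex}(\{\omega\})}=\frac{1}{P_\infty^{ex}(\Omega')},$$ is a (countably additive) probability measure on $(\Omega',\mathcal{F}')$, and it preserves ratios: $\tilde P(A)/\tilde P(B)=P_\infty^{ex}(A)/P_\infty^{ex}(B)$ for all $A,B\in\mathcal{F}'$ with $P_\infty^{ex}(B)\neq0$.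
   Context: Notation: $\mathbb{N}_0=\mathbb{N}\cup\{0\}$; $\sqcup$ denotes disjoint union; $d_{ETV}(P^{ex},Q^{ex})=\sup_{A\in\mathcal{F}}|P^{ex}(A)-Q^{ex}(A)|$. Discovery process: at every time $t\in\mathbb{N}_0$, $\Omega=\Omega_t^-\sqcup\Omega_t^+$, with $\Omega_0^+\neq\emptyset$. At time $t+1$ an element $\omega\in\Omega$ is observed. If $\omega\in\Omega_t^-$, then $\Omega_{t+1}^+=\Omega_t^+\sqcup\{\omega\}$ and $\Omega_{t+1}^-=\Omega_t^-\setminus\{\omega\}$; if $\omega\in\Omega_t^+$, then $\Omega_{t+1}^\pm=\Omega_t^\pm$. (If $\Omega'$ is finite, there is a time $T$ with $\Omega_T^+=\Omega'$, and then $P_\infty^{ex}=P_T^{ex}$.) Induced extended probability at time $0$: for $P\in\mathcal{P}$, $P_0^{ex}$ is the finite signed measure on $\mathcal{F}$ with $P_0^{ex}(A\cap\Omega_0^+)=P(A\cap\Omega_0^+)$ and $P_0^{ex}(A\cap\Omega_0^-)=-P(A\cap\Omega_0^-)$ for all $A\in\mathcal{F}$. Update from $t$ to $t+1$: if the element $\omega$ observed at time $t+1$ lies in $\Omega_t^-$, then $P_{t+1}^{ex}(\{\omega\})=|P_t^{ex}(\{\omega\})|$ and $P_{t+1}^{ex}(\{\omega'\})=P_t^{ex}(\{\omega'\})$ for every $\omega'\ne\omega$; if it lies in $\Omega_t^+$, then $P_{t+1}^{ex}=P_t^{ex}$. Values on general $A\in\mathcal{F}$ are obtained by countable additivity.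
   Formalization: The claim is proved for those P_∞^ex with P_∞^ex(Ω') ≠ 0; otherwise c is undefined, as for Ω={a,b}, P the point mass at b, Ω_0^+={a} and only a ever observed. *)

theory Defs
  imports "HOL-Probability.Probability"
begin

text \<open>Set functions are total functions on \<open>'a set\<close>; only their values on subsets of
  the ground set \<open>\<Omega>\<close> carry meaning, the sigma-algebra being \<open>Pow \<Omega>\<close>.\<close>

definition finite_signed_measure :: "'a set \<Rightarrow> ('a set \<Rightarrow> real) \<Rightarrow> bool" where
  "finite_signed_measure \<Omega> \<nu> \<longleftrightarrow>
     \<nu> {} = 0 \<and>
     (\<forall>A :: nat \<Rightarrow> 'a set. range A \<subseteq> Pow \<Omega> \<longrightarrow> disjoint_family A \<longrightarrow>
        (\<lambda>i. \<nu> (A i)) sums \<nu> (\<Union>i. A i))"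

definition d_ETV :: "'a set \<Rightarrow> ('a set \<Rightarrow> real) \<Rightarrow> ('a set \<Rightarrow> real) \<Rightarrow> real" where
  "d_ETV \<Omega> \<mu> \<nu> = (SUP A\<in>Pow \<Omega>. \<bar>\<mu> A - \<nu> A\<bar>)"

definition prob_measure_on :: "'a set \<Rightarrow> 'a measure \<Rightarrow> bool" where
  "prob_measure_on \<Omega> P \<longleftrightarrow> prob_space P \<and> space P = \<Omega> \<and> sets P = Pow \<Omega>"

text \<open>\<open>obs (Suc t)\<close> is the element observed at time \<open>t + 1\<close>; \<open>obs 0\<close> is irrelevant.\<close>

definition discovery_process ::
  "'a set \<Rightarrow> (nat \<Rightarrow> 'a) \<Rightarrow> (nat \<Rightarrow> 'a set) \<Rightarrow> (nat \<Rightarrow> 'a set) \<Rightarrow> bool" where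
  "discovery_process \<Omega> obs \<Omega>p \<Omega>m \<longleftrightarrow>
     (\<forall>t. \<Omega>m t \<union> \<Omega>p t = \<Omega> \<and> \<Omega>m t \<inter> \<Omega>p t = {}) \<and>
     \<Omega>p 0 \<noteq> {} \<and>
     (\<forall>t. obs (Suc t) \<in> \<Omega> \<and>
        (obs (Suc t) \<in> \<Omega>m t \<longrightarrow>
           \<Omega>p (Suc t) = \<Omega>p t \<union> {obs (Suc t)} \<and> \<Omega>m (Suc t) = \<Omega>m t - {obs (Suc t)}) \<and>
        (obs (Suc t) \<in> \<Omega>p t \<longrightarrow>
           \<Omega>p (Suc t) = \<Omega>p t \<and> \<Omega>m (Suc t) = \<Omega>m t))"

definition induced_ext ::
  "'a set \<Rightarrow> 'a set \<Rightarrow> 'a set \<Rightarrow> 'a measure \<Rightarrow> ('a set \<Rightarrow> real) \<Rightarrow> bool" where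
  "induced_ext \<Omega> \<Omega>p0 \<Omega>m0 P Q \<longleftrightarrow>
     finite_signed_measure \<Omega> Q \<and>
     (\<forall>A\<in>Pow \<Omega>. Q (A \<inter> \<Omega>p0) = measure P (A \<inter> \<Omega>p0) \<and>
                 Q (A \<inter> \<Omega>m0) = - measure P (A \<inter> \<Omega>m0))"

text \<open>Requiring the updated set function to be a finite signed measure is what extends its
  values on singletons to all subsets of the countable set \<open>\<Omega>\<close>.\<close>

definition ext_update ::
  "'a set \<Rightarrow> 'a set \<Rightarrow> 'a set \<Rightarrow> 'a \<Rightarrow> ('a set \<Rightarrow> real) \<Rightarrow> ('a set \<Rightarrow> real) \<Rightarrow> bool" where
  "ext_update \<Omega> \<Omega>pt \<Omega>mt \<omega> Q Q' \<longleftrightarrow>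
     finite_signed_measure \<Omega> Q' \<and>
     (\<omega> \<in> \<Omega>mt \<longrightarrow>
        Q' {\<omega>} = \<bar>Q {\<omega>}\<bar> \<and> (\<forall>\<omega>'\<in>\<Omega>. \<omega>' \<noteq> \<omega> \<longrightarrow> Q' {\<omega>'} = Q {\<omega>'})) \<and>
     (\<omega> \<in> \<Omega>pt \<longrightarrow> (\<forall>A\<in>Pow \<Omega>. Q' A = Q A))"

definition ext_update_sequence ::
  "'a set \<Rightarrow> (nat \<Rightarrow> 'a) \<Rightarrow> (nat \<Rightarrow> 'a set) \<Rightarrow> (nat \<Rightarrow> 'a set) \<Rightarrow> 'a measure \<Rightarrow>
   (nat \<Rightarrow> 'a set \<Rightarrow> real) \<Rightarrow> bool" where
  "ext_update_sequence \<Omega> obs \<Omega>p \<Omega>m P Q \<longleftrightarrow>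
     induced_ext \<Omega> (\<Omega>p 0) (\<Omega>m 0) P (Q 0) \<and>
     (\<forall>t. ext_update \<Omega> (\<Omega>p t) (\<Omega>m t) (obs (Suc t)) (Q t) (Q (Suc t)))"

text \<open>Limits are taken in the space of finite signed measures, where the supremum in
  \<open>d_ETV\<close> is over a bounded set; on arbitrary set functions it could be unspecified.\<close>

definition ext_limits ::
  "'a set \<Rightarrow> (nat \<Rightarrow> 'a) \<Rightarrow> (nat \<Rightarrow> 'a set) \<Rightarrow> (nat \<Rightarrow> 'a set) \<Rightarrow> 'a measure set \<Rightarrow>
   ('a set \<Rightarrow> real) set" where
  "ext_limits \<Omega> obs \<Omega>p \<Omega>m \<P> =
     {Qinf. finite_signed_measure \<Omega> Qinf \<and>
        (\<exists>P\<in>\<P>. \<exists>Q. ext_update_sequence \<Omega> obs \<Omega>p \<Omega>m P Q \<and>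
           (\<lambda>t. d_ETV \<Omega> (Q t) Qinf) \<longlonglongrightarrow> 0)}"

end

(* Observing a latent element only flips the sign of its own mass, so Q_t{w} is P{w}
   or -P{w} according to whether w is actual or latent at time t. Every w in Omega' is eventually
   actual, and the limit in d_ETV preserves singleton masses; as Omega' is countable, the limit
   agrees with P on all subsets of Omega'. The normalised set function is therefore P conditioned
   on Omega'. *)
theory Submission
  imports Defs
begin

section \<open>Finite signed measures on subsets of a countable set\<close>

lemma finite_signed_measure_sums:
  assumes "finite_signed_measure \<Omega> \<nu>" "range A \<subseteq> Pow \<Omega>" "disjoint_family A"
  shows "(\<lambda>i::nat. \<nu> (A i)) sums \<nu> (\<Union>i. A i)"
  using assms unfolding finite_signed_measure_def by blast

lemma finite_signed_measure_empty:
  assumes "finite_signed_measure \<Omega> \<nu>"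
  shows "\<nu> {} = 0"
  using assms unfolding finite_signed_measure_def by blast

lemma finite_signed_measure_diff:
  assumes "finite_signed_measure \<Omega> \<mu>" "finite_signed_measure \<Omega> \<nu>"
  shows "finite_signed_measure \<Omega> (\<lambda>A. \<mu> A - \<nu> A)"
  using assms unfolding finite_signed_measure_def by (auto intro!: sums_diff)

lemma finite_signed_measure_Un:
  assumes "finite_signed_measure \<Omega> \<nu>" "A \<subseteq> \<Omega>" "B \<subseteq> \<Omega>" "A \<inter> B = {}"
  shows "\<nu> (A \<union> B) = \<nu> A + \<nu> B"
proof -
  have "(\<lambda>i. \<nu> (binaryset A B i)) sums \<nu> (\<Union>i. binaryset A B i)"
    using assms
    by (intro finite_signed_measure_sums)
       (auto simp: range_binaryset_eq disjoint_family_on_def binaryset_def)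
  moreover have "(\<lambda>i. \<nu> (binaryset A B i)) sums (\<nu> A + \<nu> B)"
    using finite_signed_measure_empty[OF assms(1)] by (rule binaryset_sums)
  ultimately show ?thesis
    unfolding UN_binaryset_eq by (rule sums_unique2)
qed

text \<open>The fibres of the enumeration \<open>to_nat_on A\<close> form a disjoint sequence with
  union \<open>A\<close>. Indexing by fibres treats finite and infinite \<open>A\<close> alike: for
  finite \<open>A\<close> all but finitely many fibres are empty.\<close>

lemma finite_signed_measure_sums_singletons:
  assumes "finite_signed_measure \<Omega> \<nu>" "countable A" "A \<subseteq> \<Omega>"
  shows "(\<lambda>i. \<nu> {x \<in> A. to_nat_on A x = i}) sums \<nu> A"
proof -
  have "(\<lambda>i. \<nu> {x \<in> A. to_nat_on A x = i}) sums \<nu> (\<Union>i. {x \<in> A. to_nat_on A x = i})"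
    using assms by (intro finite_signed_measure_sums) (auto simp: disjoint_family_on_def)
  also have "(\<Union>i. {x \<in> A. to_nat_on A x = i}) = A"
    by auto
  finally show ?thesis .
qed

text \<open>Injectivity of \<open>to_nat_on A\<close> on \<open>A\<close> leaves at most one point
  per fibre. A claim about fibres thus reduces to the empty set and to singletons.\<close>

lemma to_nat_on_fibre_cases:
  assumes "countable A"
  obtains "{x \<in> A. to_nat_on A x = i} = {}"
  | y where "y \<in> A" "{x \<in> A. to_nat_on A x = i} = {y}"
proof (cases "\<exists>y\<in>A. to_nat_on A y = i")
  case True
  then obtain y where "y \<in> A" "to_nat_on A y = i" by blast
  with assms have "{x \<in> A. to_nat_on A x = i} = {y}" by auto
  with \<open>y \<in> A\<close> show ?thesis by (rule that(2))
next
  case False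
  then show ?thesis by (intro that(1)) auto
qed

text \<open>The two fibre series agree term by term, and a series has only one sum. This is how
  identities between singleton masses spread to arbitrary subsets.\<close>

lemma finite_signed_measure_eqI:
  assumes \<mu>: "finite_signed_measure \<Omega> \<mu>" and \<nu>: "finite_signed_measure \<Omega> \<nu>"
    and A: "countable A" "A \<subseteq> \<Omega>" and eq: "\<And>x. x \<in> A \<Longrightarrow> \<mu> {x} = \<nu> {x}"
  shows "\<mu> A = \<nu> A"
proof -
  have "\<mu> {x \<in> A. to_nat_on A x = i} = \<nu> {x \<in> A. to_nat_on A x = i}" for i
    using A(1)
    by (rule to_nat_on_fibre_cases[of A i])
       (simp_all only: eq finite_signed_measure_empty[OF \<mu>] finite_signed_measure_empty[OF \<nu>])
  then show ?thesis
    using finite_signed_measure_sums_singletons[OF \<mu> A]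
      finite_signed_measure_sums_singletons[OF \<nu> A] by (simp add: sums_unique2)
qed

lemma finite_signed_measure_nonneg:
  assumes \<nu>: "finite_signed_measure \<Omega> \<nu>" and A: "countable A" "A \<subseteq> \<Omega>"
    and nonneg: "\<And>x. x \<in> A \<Longrightarrow> 0 \<le> \<nu> {x}"
  shows "0 \<le> \<nu> A"
proof -
  have "0 \<le> \<nu> {x \<in> A. to_nat_on A x = i}" for i
    using A(1)
    by (rule to_nat_on_fibre_cases[of A i])
       (simp_all only: nonneg finite_signed_measure_empty[OF \<nu>] order_refl)
  then show ?thesis
    using finite_signed_measure_sums_singletons[OF \<nu> A] by (rule sums_le[OF _ sums_zero])
qed

text \<open>Countable additivity gives an ordered series; nonnegative terms make it absolutely
  convergent, hence an unordered sum that can be reindexed from the fibre numbers to the points of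
  \<open>A\<close>. The unordered form is the one in which the constant \<open>c\<close> is
  given.\<close>

lemma finite_signed_measure_has_sum:
  assumes \<nu>: "finite_signed_measure \<Omega> \<nu>" and A: "countable A" "A \<subseteq> \<Omega>"
    and nonneg: "\<And>x. x \<in> A \<Longrightarrow> 0 \<le> \<nu> {x}"
  shows "((\<lambda>x. \<nu> {x}) has_sum \<nu> A) A"
proof -
  let ?B = "\<lambda>i. {x \<in> A. to_nat_on A x = i}"
  have B_nonneg: "0 \<le> \<nu> (?B i)" for i
    using A(1)
    by (rule to_nat_on_fibre_cases[of A i])
       (simp_all only: nonneg finite_signed_measure_empty[OF \<nu>] order_refl)
  have sums: "(\<lambda>i. \<nu> (?B i)) sums \<nu> A"
    by (rule finite_signed_measure_sums_singletons[OF \<nu> A])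
  then have "((\<lambda>i. \<nu> (?B i)) has_sum \<nu> A) UNIV"
    using B_nonneg by (intro norm_summable_imp_has_sum) (auto simp: sums_iff)
  also have "?this \<longleftrightarrow> ((\<lambda>i. \<nu> (?B i)) has_sum \<nu> A) (to_nat_on A ` A)"
  proof (rule has_sum_cong_neutral)
    fix i assume "i \<in> UNIV - to_nat_on A ` A"
    then have "?B i = {}" by auto
    then show "\<nu> (?B i) = 0" by (simp only: finite_signed_measure_empty[OF \<nu>])
  qed auto
  also have "\<dots> \<longleftrightarrow> ((\<lambda>x. \<nu> (?B (to_nat_on A x))) has_sum \<nu> A) A"
    using inj_on_to_nat_on[OF A(1)] by (subst has_sum_reindex) (simp_all add: o_def)
  also have "\<dots> \<longleftrightarrow> ((\<lambda>x. \<nu> {x}) has_sum \<nu> A) A"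
  proof (rule has_sum_cong)
    fix x assume "x \<in> A"
    then have "?B (to_nat_on A x) = {x}" using A(1) by auto
    then show "\<nu> (?B (to_nat_on A x)) = \<nu> {x}" by (simp only:)
  qed
  finally show ?thesis .
qed

(* The set N of points of nonnegative mass is a positive part of a Hahn decomposition. *)
lemma finite_signed_measure_bdd_above:
  assumes "countable \<Omega>" and \<nu>: "finite_signed_measure \<Omega> \<nu>"
  shows "\<exists>K. \<forall>A\<in>Pow \<Omega>. \<nu> A \<le> K"
proof (intro exI ballI)
  fix A assume "A \<in> Pow \<Omega>"
  then have A: "A \<subseteq> \<Omega>" by simp
  define N where "N = {x \<in> \<Omega>. 0 \<le> \<nu> {x}}"
  have count: "countable B" if "B \<subseteq> \<Omega>" for B
    using that assms(1) countable_subset by blast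
  have "0 \<le> \<nu> (N - A)"
    by (rule finite_signed_measure_nonneg[OF \<nu>]) (auto simp: N_def intro!: count)
  moreover have "0 \<le> - \<nu> (A - N)"
  proof -
    have "finite_signed_measure \<Omega> (\<lambda>A. - \<nu> A)"
      using \<nu> unfolding finite_signed_measure_def by (auto intro!: sums_minus)
    then show ?thesis
      by (rule finite_signed_measure_nonneg) (use A in \<open>auto simp: N_def intro!: count\<close>)
  qed
  moreover have "\<nu> ((A \<inter> N) \<union> (N - A)) = \<nu> (A \<inter> N) + \<nu> (N - A)"
    using A by (intro finite_signed_measure_Un[OF \<nu>]) (auto simp: N_def)
  moreover have "\<nu> ((A \<inter> N) \<union> (A - N)) = \<nu> (A \<inter> N) + \<nu> (A - N)"
    using A by (intro finite_signed_measure_Un[OF \<nu>]) auto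
  moreover have "(A \<inter> N) \<union> (N - A) = N" "(A \<inter> N) \<union> (A - N) = A" by auto
  ultimately show "\<nu> A \<le> \<nu> {x \<in> \<Omega>. 0 \<le> \<nu> {x}}"
    unfolding N_def[symmetric] by simp
qed

section \<open>Convergence in \<open>d_ETV\<close> implies convergence on each set\<close>

lemma abs_diff_le_d_ETV:
  assumes "countable \<Omega>" "finite_signed_measure \<Omega> \<mu>" "finite_signed_measure \<Omega> \<nu>" "A \<subseteq> \<Omega>"
  shows "\<bar>\<mu> A - \<nu> A\<bar> \<le> d_ETV \<Omega> \<mu> \<nu>"
proof -
  obtain K where K: "\<And>B. B \<subseteq> \<Omega> \<Longrightarrow> \<mu> B - \<nu> B \<le> K"
    using finite_signed_measure_bdd_above[OF assms(1) finite_signed_measure_diff[OF assms(2,3)]]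
    by auto
  obtain L where L: "\<And>B. B \<subseteq> \<Omega> \<Longrightarrow> \<nu> B - \<mu> B \<le> L"
    using finite_signed_measure_bdd_above[OF assms(1) finite_signed_measure_diff[OF assms(3,2)]]
    by auto
  \<comment> \<open>A real supremum dominates its members only when the set is bounded above. Upper
    bounds for the difference in both orders bound its absolute value.\<close>
  have "bdd_above ((\<lambda>B. \<bar>\<mu> B - \<nu> B\<bar>) ` Pow \<Omega>)"
  proof (rule bdd_aboveI2)
    fix B assume "B \<in> Pow \<Omega>"
    then show "\<bar>\<mu> B - \<nu> B\<bar> \<le> max K L" using K[of B] L[of B] by auto
  qed
  then show ?thesis
    unfolding d_ETV_def using assms(4) by (intro cSUP_upper) auto
qed

lemma d_ETV_tendsto_imp_tendsto:
  assumes "countable \<Omega>" "\<And>t. finite_signed_measure \<Omega> (Q t)" "finite_signed_measure \<Omega> R"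
    and "(\<lambda>t. d_ETV \<Omega> (Q t) R) \<longlonglongrightarrow> 0" "A \<subseteq> \<Omega>"
  shows "(\<lambda>t. Q t A) \<longlonglongrightarrow> R A"
proof -
  have "(\<lambda>t. Q t A - R A) \<longlonglongrightarrow> 0"
    using abs_diff_le_d_ETV[OF assms(1,2,3,5)]
    by (intro Lim_null_comparison[OF _ assms(4)]) simp
  then show ?thesis by (simp add: LIM_zero_iff)
qed

section \<open>The updates along the discovery process and their limit\<close>

lemma prob_measure_on_finite_signed_measure:
  assumes "prob_measure_on \<Omega> P"
  shows "finite_signed_measure \<Omega> (measure P)"
proof -
  interpret prob_space P using assms unfolding prob_measure_on_def by blast
  show ?thesis
    using assms unfolding finite_signed_measure_def prob_measure_on_def
    by (auto intro!: finite_measure_UNION)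
qed

lemma ext_update_sequence_finite_signed_measure:
  assumes "ext_update_sequence \<Omega> obs \<Omega>p \<Omega>m P Q"
  shows "finite_signed_measure \<Omega> (Q t)"
  using assms unfolding ext_update_sequence_def induced_ext_def ext_update_def
  by (cases t) auto

text \<open>Induction on time: the mass of a point and its membership in the actual part can change
  only when that point is observed while latent.\<close>

lemma ext_update_sequence_singleton:
  assumes disc: "discovery_process \<Omega> obs \<Omega>p \<Omega>m"
    and seq: "ext_update_sequence \<Omega> obs \<Omega>p \<Omega>m P Q"
  shows "\<omega> \<in> \<Omega> \<Longrightarrow> Q t {\<omega>} = (if \<omega> \<in> \<Omega>p t then measure P {\<omega>} else - measure P {\<omega>})"
proof (induction t arbitrary: \<omega>)
  case 0
  have part: "\<Omega>m 0 \<union> \<Omega>p 0 = \<Omega>" "\<Omega>m 0 \<inter> \<Omega>p 0 = {}"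
    using disc unfolding discovery_process_def by auto
  have "Q 0 ({\<omega>} \<inter> \<Omega>p 0) = measure P ({\<omega>} \<inter> \<Omega>p 0)"
    "Q 0 ({\<omega>} \<inter> \<Omega>m 0) = - measure P ({\<omega>} \<inter> \<Omega>m 0)"
    using seq 0 unfolding ext_update_sequence_def induced_ext_def by simp_all
  with 0 part show ?case by (cases "\<omega> \<in> \<Omega>p 0") auto
next
  case (Suc t)
  let ?o = "obs (Suc t)"
  have part: "\<Omega>m t \<union> \<Omega>p t = \<Omega>" "\<Omega>m t \<inter> \<Omega>p t = {}" and o: "?o \<in> \<Omega>"
    using disc unfolding discovery_process_def by auto
  have upd: "ext_update \<Omega> (\<Omega>p t) (\<Omega>m t) ?o (Q t) (Q (Suc t))"
    using seq unfolding ext_update_sequence_def by blast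
  show ?case
  proof (cases "?o \<in> \<Omega>p t")
    case True
    then have "Q (Suc t) {\<omega>} = Q t {\<omega>}"
      using upd Suc.prems unfolding ext_update_def by simp
    moreover have "\<Omega>p (Suc t) = \<Omega>p t"
      using disc True unfolding discovery_process_def by blast
    ultimately show ?thesis using Suc by simp
  next
    case False
    then have om: "?o \<in> \<Omega>m t" using part o by blast
    then have p: "\<Omega>p (Suc t) = insert ?o (\<Omega>p t)"
      using disc unfolding discovery_process_def by simp
    show ?thesis
    proof (cases "\<omega> = ?o")
      case True
      then have "Q (Suc t) {\<omega>} = \<bar>Q t {\<omega>}\<bar>"
        using upd om unfolding ext_update_def by simp
      \<comment> \<open>By induction the old mass is \<open>measure P {\<omega>}\<close> up to sign,
        and this measure is nonnegative, so the absolute value restores it.\<close>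
      then show ?thesis using p True Suc by simp
    next
      case False
      then have "Q (Suc t) {\<omega>} = Q t {\<omega>}"
        using upd om Suc.prems unfolding ext_update_def by simp
      then show ?thesis using p False Suc by simp
    qed
  qed
qed

lemma discovery_process_incseq:
  assumes "discovery_process \<Omega> obs \<Omega>p \<Omega>m"
  shows "incseq \<Omega>p"
proof (rule incseq_SucI)
  fix t
  have "obs (Suc t) \<in> \<Omega>m t \<union> \<Omega>p t"
    using assms unfolding discovery_process_def by simp
  then show "\<Omega>p t \<le> \<Omega>p (Suc t)"
    using assms unfolding discovery_process_def by blast
qed

text \<open>Agreement is claimed only inside the union of the actual parts: a point that is never
  discovered keeps the mass \<open>- measure P {\<omega>}\<close> at all times and hence in the
  limit.\<close>

lemma ext_limits_eq_measure:
  assumes "countable \<Omega>"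
    and disc: "discovery_process \<Omega> obs \<Omega>p \<Omega>m"
    and \<P>: "\<And>P. P \<in> \<P> \<Longrightarrow> prob_measure_on \<Omega> P"
    and R: "R \<in> ext_limits \<Omega> obs \<Omega>p \<Omega>m \<P>"
  obtains P where "P \<in> \<P>" "\<And>A. A \<subseteq> (\<Union>t. \<Omega>p t) \<Longrightarrow> R A = measure P A"
proof -
  obtain P Q where fR: "finite_signed_measure \<Omega> R" and P: "P \<in> \<P>"
    and seq: "ext_update_sequence \<Omega> obs \<Omega>p \<Omega>m P Q"
    and lim: "(\<lambda>t. d_ETV \<Omega> (Q t) R) \<longlonglongrightarrow> 0"
    using R unfolding ext_limits_def by blast
  have sub: "(\<Union>t. \<Omega>p t) \<subseteq> \<Omega>"
    using disc unfolding discovery_process_def by blast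
  have single: "R {\<omega>} = measure P {\<omega>}" if \<omega>: "\<omega> \<in> (\<Union>t. \<Omega>p t)" for \<omega>
  proof -
    obtain s where s: "\<omega> \<in> \<Omega>p s" using \<omega> by blast
    have "\<omega> \<in> \<Omega>" using \<omega> sub by blast
    \<comment> \<open>A point that is actual at time \<open>s\<close> stays actual, so the sequence
      of its masses is constant from \<open>s\<close> on.\<close>
    have "Q t {\<omega>} = measure P {\<omega>}" if "t \<ge> s" for t
    proof -
      have "\<omega> \<in> \<Omega>p t"
        using s that discovery_process_incseq[OF disc] by (auto dest: incseqD)
      then show ?thesis
        using ext_update_sequence_singleton[OF disc seq \<open>\<omega> \<in> \<Omega>\<close>] by simp
    qed
    then have "(\<lambda>t. Q t {\<omega>}) \<longlonglongrightarrow> measure P {\<omega>}"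
      by (intro tendsto_eventually eventually_sequentiallyI)
    moreover have "(\<lambda>t. Q t {\<omega>}) \<longlonglongrightarrow> R {\<omega>}"
      using \<open>\<omega> \<in> \<Omega>\<close>
      by (intro d_ETV_tendsto_imp_tendsto[OF assms(1) _ fR lim]
            ext_update_sequence_finite_signed_measure[OF seq]) simp
    ultimately show ?thesis by (metis LIMSEQ_unique)
  qed
  show ?thesis
  proof (rule that[OF P])
    fix A assume A: "A \<subseteq> (\<Union>t. \<Omega>p t)"
    then have "A \<subseteq> \<Omega>" using sub by blast
    moreover from this have "countable A" using assms(1) countable_subset by blast
    moreover have "finite_signed_measure \<Omega> (measure P)"
      using \<P>[OF P] by (rule prob_measure_on_finite_signed_measure)
    ultimately show "R A = measure P A"
      using A single by (meson finite_signed_measure_eqI[OF fR] subsetD)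
  qed
qed

section \<open>Conditioning a probability measure on a subset\<close>

lemma prob_measure_on_conditional:
  assumes P: "prob_measure_on \<Omega> P" and sub: "\<Omega>' \<subseteq> \<Omega>" and pos: "measure P \<Omega>' \<noteq> 0"
  obtains M where "prob_measure_on \<Omega>' M"
    "\<And>A. A \<subseteq> \<Omega>' \<Longrightarrow> measure M A = measure P A / measure P \<Omega>'"
proof -
  interpret prob_space P using P unfolding prob_measure_on_def by blast
  have sp: "space P = \<Omega>" and sets: "sets P = Pow \<Omega>"
    using P unfolding prob_measure_on_def by auto
  \<comment> \<open>\<open>uniform_measure\<close> is conditioning on \<Omega>', but its space is
    still \<Omega>; the restriction then cuts the space down to \<Omega>'.\<close>
  let ?U = "uniform_measure P \<Omega>'"
  let ?M = "restrict_space ?U \<Omega>'"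
  \<comment> \<open>\<open>measure\<close> is \<open>emeasure\<close> read through
    \<open>enn2real\<close>, which sends both 0 and infinity to 0; a nonzero value excludes
    both.\<close>
  have nz: "emeasure P \<Omega>' \<noteq> 0" "emeasure P \<Omega>' \<noteq> \<infinity>"
    using pos by (auto simp: measure_def)
  have space: "space ?M = \<Omega>'"
    using sub sp by (auto simp: space_restrict_space)
  have eq: "measure ?M A = measure P A / measure P \<Omega>'" if "A \<subseteq> \<Omega>'" for A
  proof -
    have "measure ?M A = measure ?U A"
      using that sub sets sp by (intro measure_restrict_space) auto
    also have "\<dots> = measure P (\<Omega>' \<inter> A) / measure P \<Omega>'"
      using nz that sub sets by (intro measure_uniform_measure) (auto simp: sets)
    also have "\<Omega>' \<inter> A = A" using that by blast
    finally show ?thesis .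
  qed
  have "emeasure ?M (space ?M) = emeasure ?U \<Omega>'"
    unfolding space using sub sets sp by (intro emeasure_restrict_space) auto
  also have "\<dots> = 1"
    using nz sub sets by (simp add: emeasure_uniform_measure ennreal_divide_self less_top[symmetric])
  finally have "prob_space ?M" by (rule prob_spaceI)
  moreover have "sets ?M = Pow \<Omega>'"
  proof -
    have "sets ?M = (\<inter>) \<Omega>' ` Pow \<Omega>"
      by (simp add: sets_restrict_space sets)
    also have "\<dots> = Pow \<Omega>'"
      using sub by blast
    finally show ?thesis .
  qed
  ultimately show ?thesis
    using space eq by (intro that[of ?M]) (auto simp: prob_measure_on_def)
qed

theorem mainTheorem3:
  fixes \<Omega> \<Omega>' :: "'a set"
    and obs :: "nat \<Rightarrow> 'a"
    and \<Omega>p \<Omega>m :: "nat \<Rightarrow> 'a set"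
    and \<P> :: "'a measure set"
    and Pinf :: "'a set \<Rightarrow> real"
    and c :: real
    and Pt :: "'a set \<Rightarrow> real"
  assumes "countable \<Omega>"
    and "discovery_process \<Omega> obs \<Omega>p \<Omega>m"
    and "\<And>P. P \<in> \<P> \<Longrightarrow> prob_measure_on \<Omega> P"
    and "(\<Union>t. \<Omega>p t) = \<Omega>'"
    and "\<Omega>' \<subset> \<Omega>"
    and "countable \<Omega>'"
    and "Pinf \<in> ext_limits \<Omega> obs \<Omega>p \<Omega>m \<P>"
    and "Pinf \<Omega>' \<noteq> 0"
    and "c = 1 / (\<Sum>\<^sub>\<infinity>\<omega>\<in>\<Omega>'. Pinf {\<omega>})"
    and "\<And>A. A \<in> Pow \<Omega>' \<Longrightarrow> Pt A = c * Pinf A"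
  shows "((\<lambda>\<omega>. Pinf {\<omega>}) has_sum Pinf \<Omega>') \<Omega>' \<and>
         c = 1 / Pinf \<Omega>' \<and>
         (\<exists>M. prob_measure_on \<Omega>' M \<and> (\<forall>A\<in>Pow \<Omega>'. measure M A = Pt A)) \<and>
         (\<forall>A\<in>Pow \<Omega>'. \<forall>B\<in>Pow \<Omega>'. Pinf B \<noteq> 0 \<longrightarrow>
            Pt B \<noteq> 0 \<and> Pt A / Pt B = Pinf A / Pinf B)"
proof -
  obtain P where "P \<in> \<P>" and R: "\<And>A. A \<subseteq> \<Omega>' \<Longrightarrow> Pinf A = measure P A"
    using ext_limits_eq_measure[OF assms(1,2,3,7)] unfolding assms(4) by blast
  then have P: "prob_measure_on \<Omega> P" by (intro assms(3))
  have sub: "\<Omega>' \<subseteq> \<Omega>" using assms(5) by blast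
  have "finite_signed_measure \<Omega> Pinf"
    using assms(7) unfolding ext_limits_def by blast
  \<comment> \<open>The nonnegativity of singleton masses required here holds because
    \<open>Pinf\<close> coincides with a probability measure inside \<Omega>'.\<close>
  then have sum: "((\<lambda>\<omega>. Pinf {\<omega>}) has_sum Pinf \<Omega>') \<Omega>'"
    by (rule finite_signed_measure_has_sum[OF _ assms(6) sub]) (simp add: R)
  then have c: "c = 1 / Pinf \<Omega>'"
    using assms(9) by (simp add: infsumI)
  obtain M where "prob_measure_on \<Omega>' M"
    and M: "\<And>A. A \<subseteq> \<Omega>' \<Longrightarrow> measure M A = measure P A / measure P \<Omega>'"
    using prob_measure_on_conditional[OF P sub] assms(8) R[of \<Omega>'] by auto
  moreover have "measure M A = Pt A" if "A \<subseteq> \<Omega>'" for A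
    using that M R assms(10) c by simp
  ultimately have "\<exists>M. prob_measure_on \<Omega>' M \<and> (\<forall>A\<in>Pow \<Omega>'. measure M A = Pt A)"
    by blast
  moreover have "Pt B \<noteq> 0 \<and> Pt A / Pt B = Pinf A / Pinf B"
    if "A \<in> Pow \<Omega>'" "B \<in> Pow \<Omega>'" "Pinf B \<noteq> 0" for A B
    using that assms(8,10) c by simp
  ultimately show ?thesis
    using sum c by blast
qed

end
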